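(* Let $n$ be a positive integer and let $p:\mathbb{C}\to\mathbb{C}$ be a polynomial such that $$|p(s)|\le s^{-1}(1+s)^n\qquad\text{for all real } s>0.$$ Then $$|p(0)|\le 2n^2-n.$$
   Context: The polynomial $p$ has arbitrary complex coefficients; no positivity or reality on the positive real axis is assumed. *)

theory Defs
  imports "HOL-Analysis.Analysis" "HOL-Computational_Algebra.Polynomial"
begin

end

theory Submission
  imports Defs
begin

text \<open>
  Rotating \<open>p\<close> and taking real parts of the coefficients, we may take \<open>p\<close> real. Compare
  \<open>q(s) = s p(s)\<close> with the polynomial \<open>R\<close> given by
  \<open>R(tan\<^sup>2 \<theta>) cos\<^sup>2\<^sup>n \<theta> = cos (2n\<theta>)\<close>, which has \<open>R(0) = 1\<close> and
  \<open>R'(0) = -(2n\<^sup>2 - n)\<close>. As \<open>|q(s)| \<le> (1+s)\<^sup>n\<close>, for \<open>|c| < 1\<close> the difference \<open>R - c q\<close>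
  inherits the alternating signs of \<open>R\<close> at \<open>\<theta> = k\<pi>/2n\<close>, \<open>0 \<le> k \<le> n\<close>, so all its \<open>n\<close> roots are
  positive and its linear coefficient is negative. If \<open>|q'(0)| > 2n\<^sup>2 - n\<close>, some such \<open>c\<close> makes
  that coefficient vanish.
\<close>

section \<open>Roots and growth of real polynomials\<close>

text \<open>The degree bound leaves no room for other roots, so \<open>D\<close> is the product of
  the factors \<open>1 - s / a\<close>, which are split off one at a time.\<close>

lemma coeff_1_le_if_positive_roots:
  fixes D :: "real poly"
  assumes "finite A" "\<And>a. a \<in> A \<Longrightarrow> a > 0" "\<And>a. a \<in> A \<Longrightarrow> poly D a = 0"
    and "degree D \<le> card A" "poly D 0 = 1"
  shows "coeff D 1 \<le> - (\<Sum>a\<in>A. inverse a)"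
  using assms
proof (induction A arbitrary: D rule: finite_induct)
  case empty
  then show ?case by (simp add: coeff_eq_0)
next
  case (insert a A)
  have a: "a > 0" "poly D a = 0" using insert.prems by auto
  then obtain E where "D = [:- a, 1:] * E" using poly_eq_0_iff_dvd by (metis dvdE)
  \<comment> \<open>Absorbing \<open>- a\<close> into the cofactor gives it constant term 1, as the
    induction hypothesis demands.\<close>
  define E' where "E' = smult (- a) E"
  have D: "D = [:1, - inverse a:] * E'"
    using a by (simp add: E'_def \<open>D = _\<close> algebra_simps)
  have "E' \<noteq> 0" using D insert.prems(4) by auto
  then have "degree D = Suc (degree E')"
    unfolding D using a by (subst degree_mult_eq) auto
  then have deg: "degree E' \<le> card A" using insert by simp
  have E0: "poly E' 0 = 1" using insert.prems(4) unfolding D by simp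
  have root: "poly E' b = 0" if "b \<in> A" for b
  proof -
    have "poly D b = 0" "b \<noteq> a" using insert that by auto
    then show ?thesis using a unfolding D by (auto simp: field_simps)
  qed
  have "coeff E' 1 \<le> - (\<Sum>a\<in>A. inverse a)"
    by (rule insert.IH) (use insert.prems deg E0 root in auto)
  moreover have "coeff D 1 = coeff E' 1 - inverse a"
    using E0 unfolding D by (simp add: poly_0_coeff_0)
  ultimately show ?case using insert.hyps by simp
qed

text \<open>Substitute \<open>s = 1 / x\<close>. If the degree exceeded \<open>n\<close>, the bound
  on the reversed polynomial would keep a positive power of \<open>x\<close>, so letting
  \<open>x\<close> tend to 0 from the right would force the leading coefficient to vanish.\<close>

lemma degree_le_of_growth:
  fixes q :: "real poly"
  assumes "\<And>s. s > 0 \<Longrightarrow> \<bar>poly q s\<bar> \<le> (1 + s) ^ n"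
  shows "degree q \<le> n"
proof (rule ccontr)
  assume "\<not> degree q \<le> n"
  then have d: "degree q > n" by simp
  have bound: "\<bar>poly (reflect_poly q) x\<bar> \<le> x ^ (degree q - n) * (1 + x) ^ n" if "x > 0" for x
  proof -
    have "\<bar>poly (reflect_poly q) x\<bar> = x ^ degree q * \<bar>poly q (inverse x)\<bar>"
      using that by (simp add: poly_reflect_poly_nz abs_mult)
    also have "\<dots> \<le> x ^ degree q * (1 + inverse x) ^ n"
      using that by (intro mult_left_mono assms) auto
    also have "x ^ degree q = x ^ (degree q - n) * x ^ n"
      using d by (simp flip: power_add)
    also have "x ^ (degree q - n) * x ^ n * (1 + inverse x) ^ n
        = x ^ (degree q - n) * (x * (1 + inverse x)) ^ n"
      by (simp add: power_mult_distrib)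
    also have "x * (1 + inverse x) = 1 + x" using that by (simp add: field_simps)
    finally show ?thesis .
  qed
  have 1: "((\<lambda>x. \<bar>poly (reflect_poly q) x\<bar>) \<longlongrightarrow> \<bar>poly (reflect_poly q) 0\<bar>) (at_right 0)"
    by (intro tendsto_intros)
  have 2: "((\<lambda>x::real. x ^ (degree q - n) * (1 + x) ^ n)
      \<longlongrightarrow> 0 ^ (degree q - n) * (1 + 0) ^ n) (at_right 0)"
    by (intro tendsto_intros)
  have "\<bar>poly (reflect_poly q) 0\<bar> \<le> 0 ^ (degree q - n) * (1 + 0) ^ n"
    by (rule tendsto_le[OF _ 2 1]) (auto simp: bound eventually_at_filter)
  then have "lead_coeff q = 0" using d by (simp add: poly_0_coeff_0 power_0_left)
  then show False using d by auto
qed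

section \<open>Homogenization on the quarter circle\<close>

text \<open>Homogenizing replaces \<open>(cos t)\<^sup>2 ^ n * poly q ((tan t)\<^sup>2)\<close> by
  an expression that is continuous also at \<open>pi/2\<close>, where its value is
  \<open>coeff q n\<close>.\<close>

definition trig_hom :: "nat \<Rightarrow> real poly \<Rightarrow> real \<Rightarrow> real" where
  "trig_hom n q t = (\<Sum>k\<le>n. coeff q k * (sin t)\<^sup>2 ^ k * (cos t)\<^sup>2 ^ (n - k))"

lemma continuous_on_trig_hom [continuous_intros]: "continuous_on S (trig_hom n q)"
  unfolding trig_hom_def by (intro continuous_intros)

lemma trig_hom_diff_smult:
  "trig_hom n (p - smult c q) t = trig_hom n p t - c * trig_hom n q t"
  by (simp add: trig_hom_def algebra_simps sum_subtractf sum_distrib_left)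

lemma trig_hom_eq_poly:
  assumes "degree q \<le> n" "cos t \<noteq> 0"
  shows "trig_hom n q t = (cos t)\<^sup>2 ^ n * poly q ((tan t)\<^sup>2)"
proof -
  have "poly q ((tan t)\<^sup>2) = (\<Sum>k\<le>n. coeff q k * (tan t)\<^sup>2 ^ k)"
    unfolding poly_altdef using assms
    by (intro sum.mono_neutral_left) (auto simp: coeff_eq_0)
  moreover have "(cos t)\<^sup>2 ^ n * (coeff q k * (tan t)\<^sup>2 ^ k)
      = coeff q k * (sin t)\<^sup>2 ^ k * (cos t)\<^sup>2 ^ (n - k)" if "k \<le> n" for k
  proof -
    have "(cos t)\<^sup>2 ^ n = (cos t)\<^sup>2 ^ (n - k) * (cos t)\<^sup>2 ^ k"
      using that by (simp flip: power_add)
    moreover have "(cos t)\<^sup>2 ^ k * (tan t)\<^sup>2 ^ k = (sin t)\<^sup>2 ^ k"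
      using assms by (simp add: tan_def power_divide)
    ultimately show ?thesis by (simp add: algebra_simps)
  qed
  ultimately show ?thesis
    unfolding trig_hom_def by (auto simp only: sum_distrib_left atMost_iff intro!: sum.cong)
qed

text \<open>Carries facts proved through \<open>tan\<close> on the open interval over to the
  endpoints.\<close>

lemma closed_superset_quarter_period:
  fixes S :: "real set"
  assumes "closed S" "{0<..<pi/2} \<subseteq> S"
  shows "{0..pi/2} \<subseteq> S"
  using closure_minimal[OF assms(2,1)] by simp

text \<open>At \<open>s = (tan t)\<^sup>2\<close> the factor \<open>(cos t)\<^sup>2 ^ n\<close>
  cancels \<open>(1 + s) ^ n\<close> exactly.\<close>

lemma abs_trig_hom_le_1:
  assumes "\<And>s. s > 0 \<Longrightarrow> \<bar>poly q s\<bar> \<le> (1 + s) ^ n" "t \<in> {0..pi/2}"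
  shows "\<bar>trig_hom n q t\<bar> \<le> 1"
proof -
  have "{0<..<pi/2} \<subseteq> {t. \<bar>trig_hom n q t\<bar> \<le> 1}"
  proof
    fix t :: real assume t: "t \<in> {0<..<pi/2}"
    then have c: "cos t > 0" by (auto intro: cos_gt_zero)
    have "tan t > 0" using t by (auto intro: tan_gt_zero)
    then have "\<bar>poly q ((tan t)\<^sup>2)\<bar> \<le> (1 + (tan t)\<^sup>2) ^ n" by (intro assms) auto
    then have "(cos t)\<^sup>2 ^ n * \<bar>poly q ((tan t)\<^sup>2)\<bar> \<le> (cos t)\<^sup>2 ^ n * (1 + (tan t)\<^sup>2) ^ n"
      by (intro mult_left_mono) auto
    also have "\<dots> = ((cos t)\<^sup>2 * (1 + (tan t)\<^sup>2)) ^ n" by (simp add: power_mult_distrib)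
    also have "(cos t)\<^sup>2 * (1 + (tan t)\<^sup>2) = 1"
      using c by (simp add: tan_def power_divide distrib_left)
    finally show "t \<in> {t. \<bar>trig_hom n q t\<bar> \<le> 1}"
      using c trig_hom_eq_poly[OF degree_le_of_growth[OF assms(1)], of t] by (simp add: abs_mult)
  qed
  moreover have "closed {t. \<bar>trig_hom n q t\<bar> \<le> 1}"
    by (intro closed_Collect_le continuous_intros)
  ultimately show ?thesis
    using assms(2) closed_superset_quarter_period by blast
qed

section \<open>The extremal polynomial\<close>

text \<open>This is the \<open>R\<close> of the overview: \<open>(1 + s) ^ n\<close> times the
  Chebyshev polynomial \<open>T_n\<close> at \<open>(1 - s) / (1 + s)\<close>. The recursion is that
  of \<open>T_n\<close> with denominators cleared.\<close>

fun cheb_tan :: "nat \<Rightarrow> real poly" where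
  "cheb_tan 0 = 1"
| "cheb_tan (Suc 0) = [:1, -1:]"
| "cheb_tan (Suc (Suc n)) = [:2, -2:] * cheb_tan (Suc n) - [:1, 2, 1:] * cheb_tan n"

lemma degree_cheb_tan: "degree (cheb_tan n) \<le> n"
proof (induction n rule: cheb_tan.induct)
  case (3 n)
  have "degree ([:2, -2:] * cheb_tan (Suc n)) \<le> Suc (Suc n)"
    using 3 degree_mult_le[of "[:2, -2:]" "cheb_tan (Suc n)"] by simp
  moreover have "degree ([:1, 2, 1:] * cheb_tan n) \<le> Suc (Suc n)"
    using 3 degree_mult_le[of "[:1, 2, 1:]" "cheb_tan n"] by simp
  ultimately show ?case unfolding cheb_tan.simps by (rule degree_diff_le)
qed auto

lemma poly_cheb_tan_0: "poly (cheb_tan n) 0 = 1"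
  by (induction n rule: cheb_tan.induct) auto

text \<open>All constant terms are 1, so the recursion gives the linear coefficients the constant
  second difference -4, starting from 0 and -1.\<close>

lemma coeff_cheb_tan_1: "coeff (cheb_tan n) 1 = - (2 * (real n)\<^sup>2 - real n)"
proof (induction n rule: cheb_tan.induct)
  case (3 n)
  have "coeff (cheb_tan m) 0 = 1" for m
    using poly_cheb_tan_0 by (simp add: poly_0_coeff_0)
  with 3 show ?case by (simp add: power2_eq_square algebra_simps)
qed auto

text \<open>After scaling, the recursion reads
  \<open>cos (a + 2 * t) = 2 * cos (2 * t) * cos a - cos (a - 2 * t)\<close>.\<close>

lemma poly_cheb_tan:
  assumes "cos t \<noteq> 0"
  shows "(cos t)\<^sup>2 ^ n * poly (cheb_tan n) ((tan t)\<^sup>2) = cos (2 * real n * t)"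
proof (induction n rule: cheb_tan.induct)
  case 2
  show ?case
    using assms by (simp add: tan_def power_divide right_diff_distrib cos_double)
next
  case (3 n)
  define s where "s = (tan t)\<^sup>2"
  have 1: "(cos t)\<^sup>2 * (1 - s) = cos (2 * t)" and 2: "(cos t)\<^sup>2 * (1 + s) = 1"
    using assms by (simp_all add: s_def tan_def power_divide right_diff_distrib distrib_left cos_double)
  have "(cos t)\<^sup>2 ^ Suc (Suc n) * poly (cheb_tan (Suc (Suc n))) s
      = 2 * ((cos t)\<^sup>2 * (1 - s)) * ((cos t)\<^sup>2 ^ Suc n * poly (cheb_tan (Suc n)) s)
        - ((cos t)\<^sup>2 * (1 + s))\<^sup>2 * ((cos t)\<^sup>2 ^ n * poly (cheb_tan n) s)"
    by (simp add: algebra_simps power2_eq_square)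
  also have "\<dots> = 2 * cos (2 * t) * cos (2 * real (Suc n) * t) - cos (2 * real n * t)"
    unfolding 1 2 3[folded s_def] by simp
  also have "\<dots> = cos (2 * real (Suc (Suc n)) * t)"
  proof -
    have "cos (2 * real (Suc (Suc n)) * t) = cos (2 * real (Suc n) * t + 2 * t)"
      and "cos (2 * real n * t) = cos (2 * real (Suc n) * t - 2 * t)"
      by (simp_all add: algebra_simps)
    then show ?thesis unfolding cos_add cos_diff by simp
  qed
  finally show ?case unfolding s_def .
qed auto

lemma trig_hom_cheb_tan:
  assumes "t \<in> {0..pi/2}"
  shows "trig_hom n (cheb_tan n) t = cos (2 * real n * t)"
proof -
  have "{0<..<pi/2} \<subseteq> {t. trig_hom n (cheb_tan n) t = cos (2 * real n * t)}"
  proof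
    fix t :: real assume "t \<in> {0<..<pi/2}"
    then have "cos t > 0" by (auto intro: cos_gt_zero)
    then show "t \<in> {t. trig_hom n (cheb_tan n) t = cos (2 * real n * t)}"
      using trig_hom_eq_poly[OF degree_cheb_tan] poly_cheb_tan by simp
  qed
  moreover have "closed {t. trig_hom n (cheb_tan n) t = cos (2 * real n * t)}"
    by (intro closed_Collect_eq continuous_intros)
  ultimately show ?thesis
    using assms closed_superset_quarter_period by blast
qed

section \<open>Comparison with the extremal polynomial\<close>

lemma root_between_sign_change:
  fixes f :: "real \<Rightarrow> real"
  assumes "a \<le> b" "continuous_on {a..b} f" "f a * f b < 0"
  obtains x where "a < x" "x < b" "f x = 0"
proof -
  have "\<exists>x\<ge>a. x \<le> b \<and> f x = 0"
    using IVT'[of f a 0 b] IVT2'[of f b 0 a] assms by (auto simp: mult_less_0_iff)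
  then obtain x where x: "a \<le> x" "x \<le> b" "f x = 0" by blast
  then have "x \<noteq> a" "x \<noteq> b" using assms(3) by auto
  then show ?thesis using that x by force
qed

lemma abs_coeff_1_le:
  fixes q :: "real poly"
  assumes "n > 0" and bound: "\<And>s. s > 0 \<Longrightarrow> \<bar>poly q s\<bar> \<le> (1 + s) ^ n"
    and q0: "poly q 0 = 0"
  shows "\<bar>coeff q 1\<bar> \<le> 2 * (real n)\<^sup>2 - real n"
proof (rule ccontr)
  define N where "N = 2 * (real n)\<^sup>2 - real n"
  assume "\<not> \<bar>coeff q 1\<bar> \<le> 2 * (real n)\<^sup>2 - real n"
  then have N: "N < \<bar>coeff q 1\<bar>" by (simp add: N_def)
  have "real n \<ge> 1" using \<open>n > 0\<close> by simp
  then have "real n * 1 \<le> real n * real n" by (intro mult_left_mono) auto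
  with \<open>real n \<ge> 1\<close> have N0: "N \<ge> 0" by (simp add: N_def power2_eq_square)
  then have q1: "coeff q 1 \<noteq> 0" using N by auto
  \<comment> \<open>Chosen to make the linear coefficient of \<open>D\<close> zero;
    \<open>N < \<bar>coeff q 1\<bar>\<close> gives \<open>\<bar>c\<bar> < 1\<close>.\<close>
  define c where "c = - N / coeff q 1"
  have c: "\<bar>c\<bar> < 1" using N N0 q1 by (simp add: c_def abs_mult)
  define D where "D = cheb_tan n - smult c q"
  define F where "F = trig_hom n D"
  \<comment> \<open>The \<open>n + 1\<close> points of \<open>{0..pi/2}\<close> where
    \<open>cos (2 * real n * t)\<close> is 1 or -1, in alternation.\<close>
  define \<theta> where "\<theta> = (\<lambda>k. real k * pi / (2 * real n))"
  have degD: "degree D \<le> n"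
    unfolding D_def using degree_smult_le[of c q] degree_le_of_growth[OF bound] degree_cheb_tan
    by (meson degree_diff_le order_trans)
  have \<theta>_mono: "\<theta> i \<le> \<theta> j" if "i \<le> j" for i j
    using that by (auto simp: \<theta>_def intro!: divide_right_mono mult_right_mono)
  have \<theta>_range: "0 \<le> \<theta> k" "k \<le> n \<Longrightarrow> \<theta> k \<le> pi / 2" for k
    using \<theta>_mono[of 0 k] \<theta>_mono[of k n] \<open>n > 0\<close> by (auto simp: \<theta>_def)
  \<comment> \<open>The subtracted term is smaller than 1 in absolute value, so it cannot undo the
    sign of \<open>(-1) ^ k\<close>.\<close>
  have sign: "(-1) ^ k * F (\<theta> k) > 0" if "k \<le> n" for k
  proof -
    have mem: "\<theta> k \<in> {0..pi/2}" using \<theta>_range that by auto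
    have "\<bar>c * trig_hom n q (\<theta> k)\<bar> \<le> \<bar>c\<bar> * 1"
      unfolding abs_mult by (intro mult_left_mono abs_trig_hom_le_1 bound mem) auto
    with c have less: "\<bar>c * trig_hom n q (\<theta> k)\<bar> < 1" by simp
    have "2 * real n * \<theta> k = real k * pi" using \<open>n > 0\<close> by (simp add: \<theta>_def)
    then have "F (\<theta> k) = (-1) ^ k - c * trig_hom n q (\<theta> k)"
      using trig_hom_cheb_tan[OF mem, of n] by (simp add: F_def D_def trig_hom_diff_smult cos_npi)
    then show ?thesis using less by (cases "even k") auto
  qed
  have "\<exists>x. \<theta> k < x \<and> x < \<theta> (Suc k) \<and> F x = 0" if "k < n" for k
  proof -
    have "F (\<theta> k) * F (\<theta> (Suc k)) < 0"
      using sign[of k] sign[of "Suc k"] that by (cases "even k") (auto simp: mult_less_0_iff)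
    then show ?thesis
      using root_between_sign_change[of "\<theta> k" "\<theta> (Suc k)" F] \<theta>_mono[of k "Suc k"]
      unfolding F_def by (metis continuous_on_trig_hom lessI less_imp_le)
  qed
  then obtain x where x: "\<And>k. k < n \<Longrightarrow> \<theta> k < x k \<and> x k < \<theta> (Suc k) \<and> F (x k) = 0"
    by metis
  have x_range: "0 < x k" "x k < pi / 2" if "k < n" for k
    using x[OF that] \<theta>_range[of k] \<theta>_range[of "Suc k"] that by auto
  define r where "r = (\<lambda>k. (tan (x k))\<^sup>2)"
  have tan_pos: "tan (x k) > 0" if "k < n" for k
    using x_range[OF that] by (simp add: tan_gt_zero)
  have r_pos: "r k > 0" if "k < n" for k
    using tan_pos[OF that] by (simp add: r_def)
  \<comment> \<open>The nodes separate the zeros \<open>x k\<close>, and squaring \<open>tan\<close>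
    preserves their order since it is positive there. Hence there are \<open>n\<close> distinct
    roots, as many as the degree of \<open>D\<close> allows.\<close>
  have r_less: "r i < r j" if "i < j" "j < n" for i j
  proof -
    have "x i < \<theta> (Suc i)" "\<theta> (Suc i) \<le> \<theta> j" "\<theta> j < x j"
      using x[of i] x[of j] \<theta>_mono[of "Suc i" j] that by auto
    then have "x i < x j" by linarith
    moreover have "- (pi / 2) < x i" "x j < pi / 2" using x_range[of i] x_range[of j] that by auto
    ultimately have "tan (x i) < tan (x j)" by (intro tan_monotone)
    then show ?thesis
      unfolding r_def using tan_pos[of i] that by (intro power_strict_mono) auto
  qed
  then have inj: "inj_on r {..<n}"
    by (intro linorder_inj_onI) (force+)
  have "coeff D 1 \<le> - (\<Sum>a\<in>r ` {..<n}. inverse a)"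
  proof (rule coeff_1_le_if_positive_roots)
    show "a > 0" if "a \<in> r ` {..<n}" for a
      using that r_pos by auto
    show "poly D a = 0" if "a \<in> r ` {..<n}" for a
    proof -
      from that obtain k where k: "k < n" "a = r k" by blast
      have "cos (x k) > 0" using x_range[OF k(1)] by (intro cos_gt_zero) auto
      then show ?thesis
        using x[OF k(1)] trig_hom_eq_poly[OF degD, of "x k"] k(2) by (simp add: F_def r_def)
    qed
    show "degree D \<le> card (r ` {..<n})" using degD by (simp add: card_image[OF inj])
    show "poly D 0 = 1" by (simp add: D_def q0 poly_cheb_tan_0)
  qed auto
  \<comment> \<open>Strict because \<open>n > 0\<close> makes the sum nonempty; this contradicts the
    choice of \<open>c\<close>.\<close>
  also have "\<dots> < 0"
  proof -
    have "(\<Sum>a\<in>r ` {..<n}. inverse a) > 0"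
      using r_pos \<open>n > 0\<close> by (intro sum_pos) auto
    then show ?thesis by simp
  qed
  finally have "coeff D 1 < 0" .
  moreover have "coeff D 1 = - N - c * coeff q 1"
    using coeff_cheb_tan_1[of n] by (simp add: D_def N_def)
  ultimately show False using q1 by (simp add: c_def)
qed

section \<open>Reduction from complex to real coefficients\<close>

lemma poly_map_poly_Re: "poly (map_poly Re p) s = Re (poly p (complex_of_real s))"
  by (induction p) (auto simp: map_poly_pCons)

theorem mainTheorem3:
  fixes n :: nat and p :: "complex poly"
  assumes "n > 0"
    and "\<And>s :: real. s > 0 \<Longrightarrow> cmod (poly p (complex_of_real s)) \<le> inverse s * (1 + s) ^ n"
  shows "cmod (poly p 0) \<le> 2 * (real n)\<^sup>2 - real n"
proof -
  \<comment> \<open>The rotation makes the value at 0 real and nonnegative, so taking real parts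
    loses nothing there.\<close>
  obtain u where u: "cmod u = 1" "u * poly p 0 = cmod (poly p 0)"
  proof (cases "poly p 0 = 0")
    case True
    then show ?thesis using that[of 1] by simp
  next
    case False
    have "cmod (poly p 0) = cnj (sgn (poly p 0)) * poly p 0"
      using False by (simp add: sgn_eq field_simps complex_norm_square[symmetric] power2_eq_square)
    then show ?thesis using that[of "cnj (sgn (poly p 0))"] False by (simp add: norm_sgn)
  qed
  \<comment> \<open>Multiplying by \<open>s\<close> clears \<open>inverse s\<close> from the bound
    and turns the value at 0 into the linear coefficient.\<close>
  define q where "q = pCons 0 (map_poly Re (smult u p))"
  have "\<bar>poly q s\<bar> \<le> (1 + s) ^ n" if "s > 0" for s
  proof -
    have "\<bar>poly q s\<bar> = s * \<bar>Re (u * poly p s)\<bar>"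
      using that by (simp add: q_def poly_map_poly_Re abs_mult)
    also have "\<dots> \<le> s * cmod (u * poly p s)"
      using that by (intro mult_left_mono abs_Re_le_cmod) auto
    also have "\<dots> \<le> s * (inverse s * (1 + s) ^ n)"
      using that assms(2)[OF that] u by (intro mult_left_mono) (auto simp: norm_mult)
    also have "\<dots> = (1 + s) ^ n" using that by simp
    finally show ?thesis .
  qed
  then have "\<bar>coeff q 1\<bar> \<le> 2 * (real n)\<^sup>2 - real n"
    using \<open>n > 0\<close> by (intro abs_coeff_1_le) (auto simp: q_def)
  moreover have "coeff q 1 = cmod (poly p 0)"
    using u by (simp add: q_def coeff_map_poly poly_0_coeff_0)
  ultimately show ?thesis by simp
qed

end
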